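(* Group Strong Pairwise Monotonicity (GSPM) is preserved by GShap, but not by Baseline Shapley (BShap) or Integrated Gradients (IG). That is: (1) For every $m\ge2$, every group structure $B=\{B_1,\dots,B_l\}$ on $\{1,\dots,m\}$, all distinct $i,j\in B_k$, every $f\in\mathcal F$ that is strongly monotonic with respect to $x_i$ over $x_j$, all $\overline{\mathbf x}=(\overline x_i,\overline x_j,\overline{\mathbf x}_\neg),\mathbf x'\in\mathbb{R}^m$ with $\overline x_i>x'_i$ and $\overline x_j>x'_j$, and all $c>0$, $$\mathrm{GS}_{B_k}\bigl((\overline x_i,\overline x_j+c,\overline{\mathbf x}_\neg),\mathbf x',f\bigr)\ \le\ \mathrm{GS}_{B_k}\bigl((\overline x_i+c,\overline x_j,\overline{\mathbf x}_\neg),\mathbf x',f\bigr).$$ (2) There exist $m$, a group structure $B$, distinct $i,j\in B_k$, a function $f\in\mathcal F$ strongly monotonic with respect to $x_i$ over $x_j$, points $\overline{\mathbf x},\mathbf x'\in\mathbb{R}^m$ with $\overline x_i>x'_i$ and $\overline x_j>x'_j$, and $c>0$ such that $$\mathrm{BS}_{B_k}\bigl((\overline x_i,\overline x_j+c,\overline{\mathbf x}_\neg),\mathbf x',f\bigr)\ >\ \mathrm{BS}_{B_k}\bigl((\overline x_i+c,\overline x_j,\overline{\mathbf x}_\neg),\mathbf x',f\bigr).$$ (3) There exist $m$, a group structure $B$, distinct $i,j\in B_k$, a function $f\in\mathcal F$ strongly monotonic with respect to $x_i$ over $x_j$ (for which the IG values below are well defined), points $\overline{\mathbf x},\mathbf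 x'\in\mathbb{R}^m$ with $\overline x_i>x'_i$ and $\overline x_j>x'_j$, and $c>0$ such that $$\mathrm{IG}_{B_k}\bigl((\overline x_i,\overline x_j+c,\overline{\mathbf x}_\neg),\mathbf x',f\bigr)\ >\ \mathrm{IG}_{B_k}\bigl((\overline x_i+c,\overline x_j,\overline{\mathbf x}_\neg),\mathbf x',f\bigr).$$
   Context: $\mathcal F$ is the class of functions $f:\mathbb{R}^m\to\mathbb{R}$ that are differentiable almost everywhere. A group structure on $M=\{1,\dots,m\}$ is a partition $B=\{B_1,\dots,B_l\}$ of $M$ into pairwise disjoint nonempty sets with union $M$; put $L=\{1,\dots,l\}$. Write $\mathbf x=(x_i,x_j,\mathbf x_\neg)$, where $\mathbf x_\neg$ collects the coordinates other than the $i$-th and $j$-th. $f$ is strongly monotonic with respect to $x_i$ over $x_j$ if $f(x_i,x_j+c,\mathbf x_\neg)\le f(x_i+c,x_j,\mathbf x_\neg)$ for all $\mathbf x\in\mathbb{R}^m$ and all $c>0$. For $S\subseteq M$, $v(\overline{\mathbf x},\mathbf x',f;S)=f(\overline{\mathbf x}_S;\mathbf x'_{M\setminus S})$ is the value of $f$ at the point whose $r$-th coordinate is $\overline x_r$ if $r\in S$ and $x'_r$ otherwise. For $T\subseteq L$, $v_B(\overline{\mathbf x},\mathbf x',f;T)=v(\overline{\mathbf x},\mathbf x',f;\bigcup_{s\in T}B_s)$. GShap: $\displaystyle \mathrm{GS}_{B_k}(\overline{\mathbf x},\mathbf x',f)=\sum_{T\subseteq L\setminus\{k\}}\frac{|T|!\,(l-|T|-1)!}{l!}\bigl(v_B(\overline{\mathbf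 x},\mathbf x',f;T\cup\{k\})-v_B(\overline{\mathbf x},\mathbf x',f;T)\bigr).$ BShap: for $r\in M$, $\displaystyle \mathrm{BS}_r(\overline{\mathbf x},\mathbf x',f)=\sum_{S\subseteq M\setminus\{r\}}\frac{|S|!\,(m-|S|-1)!}{m!}\bigl(v(\overline{\mathbf x},\mathbf x',f;S\cup\{r\})-v(\overline{\mathbf x},\mathbf x',f;S)\bigr)$ and $\mathrm{BS}_{B_k}=\sum_{r\in B_k}\mathrm{BS}_r$. IG: for $r\in M$, $\displaystyle \mathrm{IG}_r(\overline{\mathbf x},\mathbf x',f)=(\overline x_r-x'_r)\int_0^1\frac{\partial f}{\partial x_r}\bigl(\mathbf x'+t(\overline{\mathbf x}-\mathbf x')\bigr)dt$ and $\mathrm{IG}_{B_k}=\sum_{r\in B_k}\mathrm{IG}_r$. *)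

theory Defs
  imports "HOL-Analysis.Analysis"
begin

text \<open>
  The dimension \<open>m\<close> has to be quantified existentially inside the statement, so a point of the
  \<open>m\<close>-dimensional space is an extensional function on the index set \<open>{1..m}\<close>, and a function on
  that space is a HOL function that is only ever evaluated at such points.
\<close>

definition Rn :: "nat \<Rightarrow> (nat \<Rightarrow> real) set"
  where "Rn m = {1..m} \<rightarrow>\<^sub>E UNIV"

text \<open>
  Total (Frechet) differentiability on \<open>Rn m\<close>. The type \<open>nat \<Rightarrow> real\<close> carries no norm, so the
  definition is written out; \<open>g\<close> is the gradient and \<open>L2_set\<close> gives the Euclidean norm.
\<close>

definition differentiable_Rn :: "nat \<Rightarrow> ((nat \<Rightarrow> real) \<Rightarrow> real) \<Rightarrow> (nat \<Rightarrow> real) \<Rightarrow> bool"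
  where "differentiable_Rn m f x \<longleftrightarrow>
    (\<exists>g. \<forall>e>0. \<exists>d>0. \<forall>y\<in>Rn m. L2_set (\<lambda>r. y r - x r) {1..m} < d \<longrightarrow>
      \<bar>f y - f x - (\<Sum>r\<in>{1..m}. g r * (y r - x r))\<bar> \<le> e * L2_set (\<lambda>r. y r - x r) {1..m})"

definition class_F :: "nat \<Rightarrow> ((nat \<Rightarrow> real) \<Rightarrow> real) set"
  where "class_F m = {f. AE x in (\<Pi>\<^sub>M r\<in>{1..m}. lborel). differentiable_Rn m f x}"

definition group_structure :: "nat \<Rightarrow> nat \<Rightarrow> (nat \<Rightarrow> nat set) \<Rightarrow> bool"
  where "group_structure m l B \<longleftrightarrow>
    disjoint_family_on B {1..l} \<and> (\<forall>k\<in>{1..l}. B k \<noteq> {}) \<and> (\<Union>k\<in>{1..l}. B k) = {1..m}"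

definition strongly_monotonic :: "nat \<Rightarrow> nat \<Rightarrow> nat \<Rightarrow> ((nat \<Rightarrow> real) \<Rightarrow> real) \<Rightarrow> bool"
  where "strongly_monotonic m i j f \<longleftrightarrow>
    (\<forall>x\<in>Rn m. \<forall>c>0. f (x(j := x j + c)) \<le> f (x(i := x i + c)))"

text \<open>
  In the following, \<open>xb\<close> is the explained point and \<open>x'\<close> the baseline. \<open>override_on x' xb S\<close> has
  coordinates \<open>xb r\<close> for \<open>r \<in> S\<close> and \<open>x' r\<close> otherwise.
\<close>

definition v :: "(nat \<Rightarrow> real) \<Rightarrow> (nat \<Rightarrow> real) \<Rightarrow> ((nat \<Rightarrow> real) \<Rightarrow> real) \<Rightarrow> nat set \<Rightarrow> real"
  where "v xb x' f S = f (override_on x' xb S)"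

definition vB :: "(nat \<Rightarrow> nat set) \<Rightarrow> (nat \<Rightarrow> real) \<Rightarrow> (nat \<Rightarrow> real) \<Rightarrow> ((nat \<Rightarrow> real) \<Rightarrow> real)
    \<Rightarrow> nat set \<Rightarrow> real"
  where "vB B xb x' f T = v xb x' f (\<Union>s\<in>T. B s)"

definition GS :: "nat \<Rightarrow> (nat \<Rightarrow> nat set) \<Rightarrow> nat \<Rightarrow> (nat \<Rightarrow> real) \<Rightarrow> (nat \<Rightarrow> real)
    \<Rightarrow> ((nat \<Rightarrow> real) \<Rightarrow> real) \<Rightarrow> real"
  where "GS l B k xb x' f =
    (\<Sum>T\<in>Pow ({1..l} - {k}). fact (card T) * fact (l - card T - 1) / fact l *
      (vB B xb x' f (T \<union> {k}) - vB B xb x' f T))"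

definition BS :: "nat \<Rightarrow> nat \<Rightarrow> (nat \<Rightarrow> real) \<Rightarrow> (nat \<Rightarrow> real) \<Rightarrow> ((nat \<Rightarrow> real) \<Rightarrow> real) \<Rightarrow> real"
  where "BS m r xb x' f =
    (\<Sum>S\<in>Pow ({1..m} - {r}). fact (card S) * fact (m - card S - 1) / fact m *
      (v xb x' f (S \<union> {r}) - v xb x' f S))"

definition BS_group :: "nat \<Rightarrow> nat set \<Rightarrow> (nat \<Rightarrow> real) \<Rightarrow> (nat \<Rightarrow> real)
    \<Rightarrow> ((nat \<Rightarrow> real) \<Rightarrow> real) \<Rightarrow> real"
  where "BS_group m G xb x' f = (\<Sum>r\<in>G. BS m r xb x' f)"

definition has_partial :: "nat \<Rightarrow> ((nat \<Rightarrow> real) \<Rightarrow> real) \<Rightarrow> (nat \<Rightarrow> real) \<Rightarrow> bool"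
  where "has_partial r f y \<longleftrightarrow> (\<lambda>u. f (y(r := u))) field_differentiable (at (y r))"

definition partial :: "nat \<Rightarrow> ((nat \<Rightarrow> real) \<Rightarrow> real) \<Rightarrow> (nat \<Rightarrow> real) \<Rightarrow> real"
  where "partial r f y = deriv (\<lambda>u. f (y(r := u))) (y r)"

definition seg :: "nat \<Rightarrow> (nat \<Rightarrow> real) \<Rightarrow> (nat \<Rightarrow> real) \<Rightarrow> real \<Rightarrow> nat \<Rightarrow> real"
  where "seg m xb x' t = (\<lambda>r\<in>{1..m}. x' r + t * (xb r - x' r))"

definition IG :: "nat \<Rightarrow> nat \<Rightarrow> (nat \<Rightarrow> real) \<Rightarrow> (nat \<Rightarrow> real) \<Rightarrow> ((nat \<Rightarrow> real) \<Rightarrow> real) \<Rightarrow> real"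
  where "IG m r xb x' f =
    (xb r - x' r) * set_lebesgue_integral lebesgue {0..1} (\<lambda>t. partial r f (seg m xb x' t))"

text \<open>
  The value \<open>IG m r xb x' f\<close> is meaningful if the partial derivative exists at almost every point
  of the segment (with respect to the parameter \<open>t\<close>) and is Lebesgue integrable in \<open>t\<close>. Using
  \<open>lebesgue\<close> rather than \<open>lborel\<close> makes both notions insensitive to the unspecified value of
  \<open>deriv\<close> on the null set of exceptional parameters.
\<close>

definition IG_well_defined :: "nat \<Rightarrow> nat \<Rightarrow> (nat \<Rightarrow> real) \<Rightarrow> (nat \<Rightarrow> real)
    \<Rightarrow> ((nat \<Rightarrow> real) \<Rightarrow> real) \<Rightarrow> bool"
  where "IG_well_defined m r xb x' f \<longleftrightarrow>
    (AE t in lebesgue. t \<in> {0..1} \<longrightarrow> has_partial r f (seg m xb x' t)) \<and>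
    set_integrable lebesgue {0..1} (\<lambda>t. partial r f (seg m xb x' t))"

definition IG_group :: "nat \<Rightarrow> nat set \<Rightarrow> (nat \<Rightarrow> real) \<Rightarrow> (nat \<Rightarrow> real)
    \<Rightarrow> ((nat \<Rightarrow> real) \<Rightarrow> real) \<Rightarrow> real"
  where "IG_group m G xb x' f = (\<Sum>r\<in>G. IG m r xb x' f)"

end

theory Submission
  imports Defs
begin

text \<open>
  GShap moves the coordinates of a group together, so each of its marginal contributions inherits
  the inequality from \<open>f\<close>. The other two attributions fail on the same example: on \<open>\<real>\<^sup>3\<close> with groups
  \<open>{1, 2}\<close> and \<open>{3}\<close> take \<open>f x = (2 * x\<^sub>1 - x\<^sub>2 + x\<^sub>3) ^ 3\<close>, which is increasing in \<open>x\<^sub>1\<close> and decreasing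
  in \<open>x\<^sub>2\<close>, with baseline \<open>0\<close>. The linear form vanishes at \<open>(3, 10, 4)\<close>, so the integrated gradients
  there are \<open>0\<close>; at \<open>(4, 9, 4)\<close> the form is \<open>3\<close>, but its part on the group \<open>{1, 2}\<close> is \<open>-1\<close>, so the
  group attribution is negative. The Baseline Shapley values are ordered in the same way.
\<close>

section \<open>Group Shapley values\<close>

lemma override_on_upd_in: "j \<in> S \<Longrightarrow> override_on g (f(j := a)) S = (override_on g f S)(j := a)"
  by (auto simp: override_on_def)

lemma override_on_upd_notin: "j \<notin> S \<Longrightarrow> override_on g (f(j := a)) S = override_on g f S"
  by (auto simp: override_on_def fun_eq_iff)

lemma override_on_Rn: "x \<in> Rn m \<Longrightarrow> y \<in> Rn m \<Longrightarrow> override_on y x S \<in> Rn m"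
  by (auto simp: Rn_def PiE_iff extensional_def override_on_def)

text \<open>Since \<open>S\<close> contains \<open>i\<close> and \<open>j\<close>, shifting
  \<open>xb\<close> at either index shifts the mixed point by the same amount, so monotonicity of
  \<open>f\<close> at the mixed point suffices.\<close>

lemma v_strongly_monotonic:
  assumes "strongly_monotonic m i j f" "i \<in> S" "j \<in> S" "xb \<in> Rn m" "x' \<in> Rn m" "c > 0"
  shows "v (xb(j := xb j + c)) x' f S \<le> v (xb(i := xb i + c)) x' f S"
proof -
  let ?x = "override_on x' xb S"
  have "?x \<in> Rn m" using assms(4,5) by (rule override_on_Rn)
  with assms(1,6) have "f (?x(j := ?x j + c)) \<le> f (?x(i := ?x i + c))"
    by (simp add: strongly_monotonic_def)
  with assms(2,3) show ?thesis
    by (simp add: v_def override_on_upd_in)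
qed

text \<open>Termwise comparison with nonnegative weights. If \<open>T\<close> omits
  \<open>k\<close>, disjointness keeps \<open>i\<close> and \<open>j\<close> out of its union, so
  the subtracted value is the same for both shifted points; with \<open>k\<close> added, both
  indices are present.\<close>

lemma GS_strongly_monotonic:
  assumes B: "disjoint_family_on B {1..l}" and k: "k \<in> {1..l}" "i \<in> B k" "j \<in> B k"
    and f: "strongly_monotonic m i j f" and x: "xb \<in> Rn m" "x' \<in> Rn m" and c: "c > 0"
  shows "GS l B k (xb(j := xb j + c)) x' f \<le> GS l B k (xb(i := xb i + c)) x' f"
  unfolding GS_def
proof (intro sum_mono mult_left_mono diff_mono)
  fix T assume "T \<in> Pow ({1..l} - {k})"
  then have notin: "r \<notin> (\<Union>s\<in>T. B s)" if "r \<in> B k" for r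
    using B k(1) that by (fastforce simp: disjoint_family_on_def)
  show "vB B (xb(j := xb j + c)) x' f (T \<union> {k}) \<le> vB B (xb(i := xb i + c)) x' f (T \<union> {k})"
    unfolding vB_def by (rule v_strongly_monotonic[OF f _ _ x c]) (use k in auto)
  show "vB B (xb(i := xb i + c)) x' f T \<le> vB B (xb(j := xb j + c)) x' f T"
    by (simp only: vB_def v_def override_on_upd_notin[OF notin[OF k(2)]]
        override_on_upd_notin[OF notin[OF k(3)]])
qed simp

section \<open>Functions of a linear form\<close>

definition linear_form :: "nat \<Rightarrow> (nat \<Rightarrow> real) \<Rightarrow> (nat \<Rightarrow> real) \<Rightarrow> real"
  where "linear_form m a x = (\<Sum>r\<in>{1..m}. a r * x r)"

lemma linear_form_diff:
  "linear_form m a y - linear_form m a x = (\<Sum>r\<in>{1..m}. a r * (y r - x r))"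
  by (simp add: linear_form_def sum_subtractf algebra_simps)

lemma linear_form_upd:
  assumes "r \<in> {1..m}"
  shows "linear_form m a (x(r := u)) = linear_form m a x + a r * (u - x r)"
proof -
  have "linear_form m a (x(r := u)) - linear_form m a x
      = (\<Sum>s\<in>{1..m}. if s = r then a r * (u - x r) else 0)"
    unfolding linear_form_diff by (intro sum.cong) auto
  with assms show ?thesis by simp
qed

lemma linear_form_seg:
  "linear_form m a (seg m xb x' t)
    = linear_form m a x' + t * (linear_form m a xb - linear_form m a x')"
  unfolding linear_form_diff
  by (simp add: linear_form_def seg_def sum.distrib sum_subtractf sum_distrib_left algebra_simps)

lemma abs_linear_form_diff_le:
  "\<bar>linear_form m a y - linear_form m a x\<bar>
    \<le> L2_set a {1..m} * L2_set (\<lambda>r. y r - x r) {1..m}"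
proof -
  have "\<bar>linear_form m a y - linear_form m a x\<bar> \<le> (\<Sum>r\<in>{1..m}. \<bar>a r\<bar> * \<bar>y r - x r\<bar>)"
    unfolding linear_form_diff by (rule order_trans[OF sum_abs]) (simp add: abs_mult)
  also have "\<dots> \<le> L2_set a {1..m} * L2_set (\<lambda>r. y r - x r) {1..m}"
    by (rule L2_set_mult_ineq)
  finally show ?thesis .
qed

text \<open>Chain rule: the gradient is \<open>D * a\<close>, and Cauchy-Schwarz controls the
  increment of the form by the distance.\<close>

lemma differentiable_Rn_linear_form:
  assumes "(\<phi> has_real_derivative D) (at (linear_form m a x))"
  shows "differentiable_Rn m (\<lambda>x. \<phi> (linear_form m a x)) x"
  unfolding differentiable_Rn_def
proof (intro exI[of _ "\<lambda>r. D * a r"] allI impI)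
  fix e :: real assume e: "e > 0"
  let ?L = "linear_form m a"
  \<comment> \<open>The summand 1 makes \<open>A\<close> positive even for \<open>a = 0\<close>, so
    that \<open>e / A\<close> and \<open>d / A\<close> are usable tolerances.\<close>
  define A where "A = L2_set a {1..m} + 1"
  have A: "A > 0" by (simp add: A_def add_nonneg_pos)
  with e have "e / A > 0" by simp
  with assms obtain d where d: "d > 0" and
    bound: "\<And>s. \<bar>s - ?L x\<bar> < d \<Longrightarrow> \<bar>\<phi> s - \<phi> (?L x) - D * (s - ?L x)\<bar> \<le> e / A * \<bar>s - ?L x\<bar>"
    unfolding has_field_derivative_def has_derivative_at_alt by fastforce
  show "\<exists>d>0. \<forall>y\<in>Rn m. L2_set (\<lambda>r. y r - x r) {1..m} < d \<longrightarrow>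
      \<bar>\<phi> (?L y) - \<phi> (?L x) - (\<Sum>r\<in>{1..m}. D * a r * (y r - x r))\<bar>
        \<le> e * L2_set (\<lambda>r. y r - x r) {1..m}"
  proof (intro exI[of _ "d / A"] conjI ballI impI)
    fix y assume y: "L2_set (\<lambda>r. y r - x r) {1..m} < d / A"
    have le: "\<bar>?L y - ?L x\<bar> \<le> A * L2_set (\<lambda>r. y r - x r) {1..m}"
      using abs_linear_form_diff_le[of m a y x] L2_set_nonneg[of "\<lambda>r. y r - x r" "{1..m}"]
      unfolding A_def distrib_right by linarith
    also have "\<dots> < d" using y A by (simp add: field_simps)
    finally have "\<bar>\<phi> (?L y) - \<phi> (?L x) - D * (?L y - ?L x)\<bar> \<le> e / A * \<bar>?L y - ?L x\<bar>"
      by (rule bound)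
    also have "\<dots> \<le> e / A * (A * L2_set (\<lambda>r. y r - x r) {1..m})"
      using le e A by (intro mult_left_mono) auto
    finally show "\<bar>\<phi> (?L y) - \<phi> (?L x) - (\<Sum>r\<in>{1..m}. D * a r * (y r - x r))\<bar>
        \<le> e * L2_set (\<lambda>r. y r - x r) {1..m}"
      using A by (simp add: linear_form_diff sum_distrib_left mult.assoc)
  qed (use d A in auto)
qed

lemma class_F_cube: "(\<lambda>x. linear_form m a x ^ 3) \<in> class_F m"
  unfolding class_F_def
  by (auto intro!: AE_I2 differentiable_Rn_linear_form[where \<phi> = "\<lambda>s. s ^ 3"]
      derivative_eq_intros)

text \<open>The two shifts raise the form by \<open>a j * c\<close> and \<open>a i * c\<close>, and
  the cube is increasing on all of the real line.\<close>

lemma strongly_monotonic_cube: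
  assumes "i \<in> {1..m}" "j \<in> {1..m}" "a j \<le> a i"
  shows "strongly_monotonic m i j (\<lambda>x. linear_form m a x ^ 3)"
  using assms unfolding strongly_monotonic_def
  by (auto simp: linear_form_upd intro!: power_mono_odd)

lemma
  assumes "r \<in> {1..m}"
  shows has_partial_cube: "has_partial r (\<lambda>x. linear_form m a x ^ 3) y"
    and partial_cube: "partial r (\<lambda>x. linear_form m a x ^ 3) y = 3 * a r * (linear_form m a y)\<^sup>2"
proof -
  have "((\<lambda>u. (linear_form m a y + a r * (u - y r)) ^ 3) has_real_derivative
      3 * a r * (linear_form m a y)\<^sup>2) (at (y r))"
    by (auto intro!: derivative_eq_intros)
  then have *: "((\<lambda>u. linear_form m a (y(r := u)) ^ 3) has_real_derivative
      3 * a r * (linear_form m a y)\<^sup>2) (at (y r))"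
    using assms by (simp add: linear_form_upd)
  from * show "has_partial r (\<lambda>x. linear_form m a x ^ 3) y"
    unfolding has_partial_def field_differentiable_def by blast
  from * show "partial r (\<lambda>x. linear_form m a x ^ 3) y = 3 * a r * (linear_form m a y)\<^sup>2"
    unfolding partial_def by (rule DERIV_imp_deriv)
qed

section \<open>Integrated gradients of the cube of a linear form\<close>

context
  fixes m r :: nat and a xb x' :: "nat \<Rightarrow> real"
  assumes r: "r \<in> {1..m}" and base: "linear_form m a x' = 0"
begin

text \<open>As the form vanishes at the baseline, on the segment it equals \<open>t\<close> times
  its value at \<open>xb\<close>. The factor \<open>3 * t\<^sup>2\<close> is kept apart because its
  integral over \<open>{0..1}\<close> is 1.\<close>

lemma partial_cube_seg:
  "partial r (\<lambda>x. linear_form m a x ^ 3) (seg m xb x' t)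
    = a r * (linear_form m a xb)\<^sup>2 * (3 * t\<^sup>2)"
  using r base by (simp add: partial_cube linear_form_seg power_mult_distrib)

lemma set_integrable_partial_cube:
  "set_integrable lebesgue {0..1} (\<lambda>t. partial r (\<lambda>x. linear_form m a x ^ 3) (seg m xb x' t))"
  unfolding partial_cube_seg
  by (intro absolutely_integrable_continuous_real continuous_intros)

lemma IG_well_defined_cube: "IG_well_defined m r xb x' (\<lambda>x. linear_form m a x ^ 3)"
  using r set_integrable_partial_cube by (simp add: IG_well_defined_def has_partial_cube)

lemma IG_cube:
  "IG m r xb x' (\<lambda>x. linear_form m a x ^ 3) = (xb r - x' r) * (a r * (linear_form m a xb)\<^sup>2)"
proof -
  have "((\<lambda>t::real. 3 * t\<^sup>2) has_integral (1 ^ 3 - 0 ^ 3)) {0..1}"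
    by (rule fundamental_theorem_of_calculus)
      (auto intro!: derivative_eq_intros
        simp flip: has_real_derivative_iff_has_vector_derivative)
  then have "((\<lambda>t. a r * (linear_form m a xb)\<^sup>2 * (3 * t\<^sup>2)) has_integral
      a r * (linear_form m a xb)\<^sup>2 * (1 ^ 3 - 0 ^ 3)) {0..1}"
    by (rule has_integral_mult_right)
  from integral_unique[OF this] show ?thesis
    \<comment> \<open>Integrability turns the Lebesgue integral into the gauge integral, which the
      fundamental theorem has just evaluated.\<close>
    unfolding IG_def set_lebesgue_integral_eq_integral(2)[OF set_integrable_partial_cube]
    unfolding partial_cube_seg by simp
qed

end

section \<open>The counterexample\<close>

lemma sum_Pow_pair:
  assumes "p \<noteq> q"
  shows "sum g (Pow {p, q}) = g {} + g {p} + g {q} + g {p, q}"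
proof -
  have "Pow {p, q} = {{}, {p}, {q}, {p, q}}" by auto
  with assms show ?thesis by (simp add: add.assoc doubleton_eq_iff)
qed

text \<open>The Shapley weights for three players are 1/3, 1/6, 1/3 for coalitions of size 0, 1,
  2.\<close>

lemma BS_3:
  assumes "{p, q, r} = {1..3}" "p \<noteq> q" "p \<noteq> r" "q \<noteq> r"
  shows "BS 3 r xb x' f = (v xb x' f {r} - v xb x' f {}) / 3
    + (v xb x' f {p, r} - v xb x' f {p}) / 6 + (v xb x' f {q, r} - v xb x' f {q}) / 6
    + (v xb x' f {p, q, r} - v xb x' f {p, q}) / 3"
proof -
  have "{1..3} - {r} = {p, q}" using assms by (simp flip: assms(1)) blast
  with assms show ?thesis
    by (simp add: BS_def sum_Pow_pair fact_numeral insert_commute field_simps)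
qed

definition cubic_coeffs :: "nat \<Rightarrow> real"
  where "cubic_coeffs r = (if r = 1 then 2 else if r = 2 then -1 else 1)"

definition cubic :: "(nat \<Rightarrow> real) \<Rightarrow> real"
  where "cubic x = linear_form 3 cubic_coeffs x ^ 3"

text \<open>With \<open>c = 1\<close>, raising coordinate 2 gives (3, 10, 4) and raising coordinate
  1 gives (4, 9, 4). The restriction makes the function extensional, as \<open>Rn\<close>
  demands.\<close>

definition point :: "nat \<Rightarrow> real"
  where "point = (\<lambda>r\<in>{1..3}. if r = 1 then 3 else if r = 2 then 9 else 4)"

definition baseline :: "nat \<Rightarrow> real"
  where "baseline = (\<lambda>r\<in>{1..3}. 0)"

definition groups :: "nat \<Rightarrow> nat set"
  where "groups k = (if k = 1 then {1, 2} else {3})"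

lemma atLeastAtMost_1_3: "{1..3::nat} = {1, 2, 3}"
  by auto

lemma linear_form_coeffs: "linear_form 3 cubic_coeffs x = 2 * x 1 - x 2 + x 3"
  by (simp add: linear_form_def cubic_coeffs_def atLeastAtMost_1_3 del: One_nat_def)

text \<open>The baseline is 0, so only coordinates in the coalition contribute to the form.\<close>

lemma v_cubic:
  "v xb baseline cubic S = ((if 1 \<in> S then 2 * xb 1 else 0) - (if 2 \<in> S then xb 2 else 0)
    + (if 3 \<in> S then xb 3 else 0)) ^ 3"
  unfolding v_def cubic_def linear_form_coeffs by (simp only: override_on_def baseline_def) simp

text \<open>Side conditions shared by both counterexamples.\<close>

lemma cubic_setup:
  "group_structure 3 2 groups" "1 \<in> groups 1" "2 \<in> groups 1" "cubic \<in> class_F 3"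
  "strongly_monotonic 3 1 2 cubic" "point \<in> Rn 3" "baseline \<in> Rn 3"
  "point 1 > baseline 1" "point 2 > baseline 2"
proof -
  have 2: "{1..2::nat} = {1, 2}" by auto
  show "group_structure 3 2 groups"
    unfolding group_structure_def disjoint_family_on_def 2 atLeastAtMost_1_3 groups_def by auto
  show "cubic \<in> class_F 3"
    using class_F_cube[of 3 cubic_coeffs] by (simp add: cubic_def[abs_def])
  show "strongly_monotonic 3 1 2 cubic"
    unfolding cubic_def[abs_def] by (rule strongly_monotonic_cube) (simp_all add: cubic_coeffs_def)
  show "point \<in> Rn 3" "baseline \<in> Rn 3"
    by (simp_all only: Rn_def point_def baseline_def restrict_PiE_iff UNIV_I) simp_all
  show "point 1 > baseline 1" "point 2 > baseline 2"
    by (simp_all add: point_def baseline_def)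
  show "1 \<in> groups 1" "2 \<in> groups 1"
    by (simp_all add: groups_def)
qed

text \<open>The group values are -304 at (3, 10, 4) and -307 at (4, 9, 4).\<close>

lemma BS_cubic:
  "BS_group 3 (groups 1) (point(2 := point 2 + 1)) baseline cubic
    > BS_group 3 (groups 1) (point(1 := point 1 + 1)) baseline cubic"
proof -
  \<comment> \<open>\<open>BS_3\<close> is instantiated for both players because its left-hand side
    does not determine \<open>p\<close> and \<open>q\<close>.\<close>
  have BS: "BS 3 1 xb x' f = (v xb x' f {1} - v xb x' f {}) / 3
      + (v xb x' f {2, 1} - v xb x' f {2}) / 6 + (v xb x' f {3, 1} - v xb x' f {3}) / 6
      + (v xb x' f {2, 3, 1} - v xb x' f {2, 3}) / 3"
    "BS 3 2 xb x' f = (v xb x' f {2} - v xb x' f {}) / 3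
      + (v xb x' f {1, 2} - v xb x' f {1}) / 6 + (v xb x' f {3, 2} - v xb x' f {3}) / 6
      + (v xb x' f {1, 3, 2} - v xb x' f {1, 3}) / 3" for xb x' f
    by (rule BS_3; force)+
  show ?thesis
    by (simp add: BS_group_def groups_def BS v_cubic point_def del: One_nat_def)
qed

lemma IG_cubic:
  assumes "r \<in> groups 1"
  shows "IG_well_defined 3 r xb baseline cubic"
    and "IG 3 r xb baseline cubic
      = (xb r - baseline r) * (cubic_coeffs r * (linear_form 3 cubic_coeffs xb)\<^sup>2)"
proof -
  have r: "r \<in> {1..3}" using assms by (auto simp: groups_def)
  have base: "linear_form 3 cubic_coeffs baseline = 0"
    by (simp add: linear_form_def baseline_def)
  show "IG_well_defined 3 r xb baseline cubic"
    "IG 3 r xb baseline cubic = (xb r - baseline r) * (cubic_coeffs r * (linear_form 3 cubic_coeffs xb)\<^sup>2)"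
    using IG_well_defined_cube[OF r base] IG_cube[OF r base]
    by (simp_all add: cubic_def[abs_def])
qed

lemma IG_group_cubic:
  "IG_group 3 (groups 1) (point(2 := point 2 + 1)) baseline cubic
    > IG_group 3 (groups 1) (point(1 := point 1 + 1)) baseline cubic"
proof -
  \<comment> \<open>The group part of the form times the square of the whole form: 0 at (3, 10, 4)
    and -9 at (4, 9, 4).\<close>
  have IG: "IG_group 3 (groups 1) xb baseline cubic
      = (2 * xb 1 - xb 2) * (2 * xb 1 - xb 2 + xb 3)\<^sup>2" for xb
    using IG_cubic(2)[of 1 xb] IG_cubic(2)[of 2 xb]
    by (simp add: IG_group_def groups_def cubic_coeffs_def linear_form_coeffs baseline_def
        algebra_simps del: One_nat_def)
  show ?thesis
    unfolding IG by (simp add: point_def)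
qed

theorem proposition4p20:
  "(\<forall>(m::nat) (l::nat) (B::nat \<Rightarrow> nat set) (k::nat) (i::nat) (j::nat)
       (f::(nat \<Rightarrow> real) \<Rightarrow> real) (xb::nat \<Rightarrow> real) (x'::nat \<Rightarrow> real) (c::real).
      m \<ge> 2 \<and> group_structure m l B \<and> k \<in> {1..l} \<and> i \<in> B k \<and> j \<in> B k \<and> i \<noteq> j \<and>
      f \<in> class_F m \<and> strongly_monotonic m i j f \<and>
      xb \<in> Rn m \<and> x' \<in> Rn m \<and> xb i > x' i \<and> xb j > x' j \<and> c > 0 \<longrightarrow>
      GS l B k (xb(j := xb j + c)) x' f \<le> GS l B k (xb(i := xb i + c)) x' f)
   \<and>
   (\<exists>(m::nat) (l::nat) (B::nat \<Rightarrow> nat set) (k::nat) (i::nat) (j::nat)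
       (f::(nat \<Rightarrow> real) \<Rightarrow> real) (xb::nat \<Rightarrow> real) (x'::nat \<Rightarrow> real) (c::real).
      group_structure m l B \<and> k \<in> {1..l} \<and> i \<in> B k \<and> j \<in> B k \<and> i \<noteq> j \<and>
      f \<in> class_F m \<and> strongly_monotonic m i j f \<and>
      xb \<in> Rn m \<and> x' \<in> Rn m \<and> xb i > x' i \<and> xb j > x' j \<and> c > 0 \<and>
      BS_group m (B k) (xb(j := xb j + c)) x' f > BS_group m (B k) (xb(i := xb i + c)) x' f)
   \<and>
   (\<exists>(m::nat) (l::nat) (B::nat \<Rightarrow> nat set) (k::nat) (i::nat) (j::nat)
       (f::(nat \<Rightarrow> real) \<Rightarrow> real) (xb::nat \<Rightarrow> real) (x'::nat \<Rightarrow> real) (c::real).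
      group_structure m l B \<and> k \<in> {1..l} \<and> i \<in> B k \<and> j \<in> B k \<and> i \<noteq> j \<and>
      f \<in> class_F m \<and> strongly_monotonic m i j f \<and>
      xb \<in> Rn m \<and> x' \<in> Rn m \<and> xb i > x' i \<and> xb j > x' j \<and> c > 0 \<and>
      (\<forall>r\<in>B k. IG_well_defined m r (xb(j := xb j + c)) x' f \<and>
                IG_well_defined m r (xb(i := xb i + c)) x' f) \<and>
      IG_group m (B k) (xb(j := xb j + c)) x' f > IG_group m (B k) (xb(i := xb i + c)) x' f)"
proof (intro conjI)
  show "\<exists>m l B k i j f xb x' c.
      group_structure m l B \<and> k \<in> {1..l} \<and> i \<in> B k \<and> j \<in> B k \<and> i \<noteq> j \<and>
      f \<in> class_F m \<and> strongly_monotonic m i j f \<and>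
      xb \<in> Rn m \<and> x' \<in> Rn m \<and> xb i > x' i \<and> xb j > x' j \<and> c > 0 \<and>
      BS_group m (B k) (xb(j := xb j + c)) x' f > BS_group m (B k) (xb(i := xb i + c)) x' f"
    by (rule exI[of _ 3], rule exI[of _ 2], rule exI[of _ groups], rule exI[of _ 1],
        rule exI[of _ 1], rule exI[of _ 2], rule exI[of _ cubic], rule exI[of _ point],
        rule exI[of _ baseline], rule exI[of _ 1])
      (intro conjI cubic_setup BS_cubic; simp)
next
  show "\<exists>m l B k i j f xb x' c.
      group_structure m l B \<and> k \<in> {1..l} \<and> i \<in> B k \<and> j \<in> B k \<and> i \<noteq> j \<and>
      f \<in> class_F m \<and> strongly_monotonic m i j f \<and>
      xb \<in> Rn m \<and> x' \<in> Rn m \<and> xb i > x' i \<and> xb j > x' j \<and> c > 0 \<and>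
      (\<forall>r\<in>B k. IG_well_defined m r (xb(j := xb j + c)) x' f \<and>
                IG_well_defined m r (xb(i := xb i + c)) x' f) \<and>
      IG_group m (B k) (xb(j := xb j + c)) x' f > IG_group m (B k) (xb(i := xb i + c)) x' f"
    by (rule exI[of _ 3], rule exI[of _ 2], rule exI[of _ groups], rule exI[of _ 1],
        rule exI[of _ 1], rule exI[of _ 2], rule exI[of _ cubic], rule exI[of _ point],
        rule exI[of _ baseline], rule exI[of _ 1])
      (intro conjI ballI cubic_setup IG_cubic(1) IG_group_cubic; simp)
\<comment> \<open>What remains is the universal claim on \<open>GS\<close>;
  \<open>group_structure\<close> supplies the disjointness.\<close>
qed (intro allI impI, elim conjE, rule GS_strongly_monotonic, auto simp: group_structure_def)

end
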